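(* Let $\mathbf{F}_q$ be a finite field with $q$ elements and let $n$ be a positive integer. The monoids $(M(n\times n;E_q),\cdot)$ and $(MF_n^n(\mathbf{F}_q),\circ)$ are isomorphic.
   Context: Convention: $x^0=1$ for all $x\in\mathbf{F}_q$ (including $x=0$). For $c\in\mathbb{N}_0$ (nonnegative integers), $red_q(c)$ denotes the degree of the (unique) remainder of the polynomial division of $\tau^c$ by $\tau^q-\tau$ in $\mathbf{F}_q[\tau]$. The exponents semiring is $E_q=\{0,1,\dots,q-1\}$ with addition $a\oplus b:=red_q(a+b)$ and multiplication $a\bullet b:=red_q(ab)$. $M(n\times n;E_q)$ is the set of $n\times n$ matrices with entries in $E_q$, and $\cdot$ is matrix multiplication defined through $\oplus$ and $\bullet$: $(A\cdot B)_{ij}=A_{i1}\bullet B_{1j}\oplus\dots\oplus A_{in}\bullet B_{nj}$; its identity element is the unit matrix. $MF_n^n(\mathbf{F}_q)$ is the set of monomial dynamical systems, i.e. of maps $f:\mathbf{F}_q^n\to\mathbf{F}_q^n$ for which there is a matrix $F\in M(n\times n;E_q)$ with $f_i(x)=x_1^{F_{i1}}\cdots x_n^{F_{in}}$ for all $x\in\mathbf{F}_q^n$ and $i=1,\dots,n$; $\circ$ is composition of maps. *)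

theory Defs
  imports
    "HOL-Analysis.Finite_Cartesian_Product"
    "HOL-Analysis.Cartesian_Space"
    "HOL-Computational_Algebra.Polynomial"
    "HOL-Algebra.Ring"
begin

text \<open>
  The finite field is a type \<open>'a :: {field, finite}\<close>, so that \<open>q = CARD('a)\<close>; the size of
  vectors and matrices is \<open>n = CARD('n)\<close> for a finite index type \<open>'n\<close>. Constants whose type does
  not mention the field take it as an argument of type \<open>'a itself\<close>.
\<close>

definition red :: "'a::{field,finite} itself \<Rightarrow> nat \<Rightarrow> nat" where
  "red _ c = degree ((monom 1 c :: 'a poly) mod (monom 1 CARD('a) - monom 1 1))"

definition exponent_semiring :: "'a::{field,finite} itself \<Rightarrow> nat ring" where
  "exponent_semiring T =
     \<lparr>carrier = {0..<CARD('a)},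
      mult = (\<lambda>a b. red T (a * b)),
      one = 1,
      zero = 0,
      add = (\<lambda>a b. red T (a + b))\<rparr>"

text \<open>
  The matrix product is written with the operations of the exponent semiring; the library's \<open>**\<close>
  would use ordinary addition and multiplication of natural numbers. The iterated sum
  is a \<open>finsum\<close>, which is independent of the order of summation because the exponent semiring
  is a commutative semiring.
\<close>

definition exponent_matrix_monoid ::
    "'a::{field,finite} itself \<Rightarrow> (nat ^ 'n ^ 'n::finite) monoid" where
  "exponent_matrix_monoid T =
     \<lparr>carrier = {A. \<forall>i j. A $ i $ j \<in> carrier (exponent_semiring T)},
      mult = (\<lambda>A B. \<chi> i j. \<Oplus>\<^bsub>exponent_semiring T\<^esub>k\<in>UNIV.
                 A $ i $ k \<otimes>\<^bsub>exponent_semiring T\<^esub> B $ k $ j),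
      one = mat 1\<rparr>"

definition monomial_systems :: "('a::{field,finite} ^ 'n::finite \<Rightarrow> 'a ^ 'n) set" where
  "monomial_systems =
     {f. \<exists>F :: nat ^ 'n ^ 'n.
           (\<forall>i j. F $ i $ j \<in> carrier (exponent_semiring TYPE('a))) \<and>
           (\<forall>x i. f x $ i = (\<Prod>j\<in>UNIV. (x $ j) ^ (F $ i $ j)))}"

definition monomial_system_monoid :: "('a::{field,finite} ^ 'n::finite \<Rightarrow> 'a ^ 'n) monoid" where
  "monomial_system_monoid = \<lparr>carrier = monomial_systems, mult = (\<circ>), one = id\<rparr>"

end

theory Submission
  imports Defs
begin

text \<open>
  An exponent below \<open>q\<close> is determined by the power function \<open>x \<mapsto> x\<^sup>a\<close> on the field, since a
  nonzero polynomial of degree below \<open>q\<close> cannot vanish on all \<open>q\<close> elements, and reduction modulo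
  \<open>\<tau>\<^sup>q - \<tau>\<close> does not change this function. So the exponent semiring is a faithful copy of
  the power functions, and a matrix is determined by its monomial system. The associativity and
  unit laws of both monoids are then those of composition of maps.
\<close>

text \<open>
  The library's \<open>finite_field_power_card_eq_same\<close> does not apply: its class \<open>finite_field\<close> is
  not implied by the sort \<open>{field,finite}\<close>.
\<close>
lemma finite_field_power_card:
  fixes x :: "'a::{field,finite}"
  shows "x ^ CARD('a) = x"
proof (cases "x = 0")
  case False
  let ?U = "UNIV - {0::'a}"
  \<comment> \<open>Multiplication by a nonzero \<open>x\<close> permutes the nonzero elements;
    comparing their product before and after, then cancelling it, leaves
    \<open>x ^ (q - 1) = 1\<close>.\<close>
  have "bij_betw ((*) x) ?U ?U"
    by (rule bij_betwI[where g = "\<lambda>y. y / x"]) (use False in auto)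
  then have "(\<Prod>y\<in>?U. x * y) = \<Prod>?U"
    by (rule prod.reindex_bij_betw)
  then have "x ^ (CARD('a) - 1) * \<Prod>?U = \<Prod>?U"
    by (simp add: prod.distrib card_Diff_singleton)
  then have "x ^ (CARD('a) - 1) = 1"
    by simp
  then show ?thesis
    by (metis mult_1 power_minus_mult zero_less_card_finite)
qed simp

lemma two_le_card_field: "2 \<le> CARD('a::{field,finite})"
proof -
  have "card {0, 1::'a} \<le> CARD('a)"
    by (intro card_mono) auto
  then show ?thesis
    by simp
qed

text \<open>Modulo \<open>\<tau>^q - \<tau>\<close> an exponent of at least \<open>q\<close> can be
  lowered by \<open>q - 1\<close>, which is positive. Repeating this ends at a single monomial with
  coefficient 1, so the degree taken in \<open>red\<close> determines the whole remainder.\<close>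

lemma monom_mod_eq_monom:
  "\<exists>r<CARD('a). (monom 1 c :: 'a::{field,finite} poly) mod (monom 1 CARD('a) - monom 1 1) = monom 1 r"
proof (induction c rule: less_induct)
  case (less c)
  let ?q = "CARD('a)" and ?P = "monom 1 CARD('a) - monom 1 1 :: 'a poly"
  have q: "2 \<le> ?q"
    by (rule two_le_card_field)
  show ?case
  proof (cases "c < ?q")
    case True
    have "degree ?P = ?q"
      using q by (simp add: diff_conv_add_uminus degree_add_eq_left degree_monom_eq del: add_uminus_conv_diff)
    then have "monom 1 c mod ?P = monom 1 c"
      using True by (intro mod_poly_less) (simp add: degree_monom_eq)
    with True show ?thesis
      by blast
  next
    case False
    have "monom 1 c = monom 1 (c - ?q + 1) + monom 1 (c - ?q) * ?P"
      using False by (simp add: algebra_simps mult_monom)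
    then have "monom 1 c mod ?P = monom 1 (c - ?q + 1) mod ?P"
      by (metis mod_mult_self1)
    moreover have "c - ?q + 1 < c"
      using False q by linarith
    ultimately show ?thesis
      using less by metis
  qed
qed

lemma red_less: "red TYPE('a::{field,finite}) c < CARD('a)"
  using monom_mod_eq_monom[of c, where 'a = 'a] by (auto simp: red_def degree_monom_eq)

text \<open>The divisor vanishes at every field element by \<open>finite_field_power_card\<close>,
  so a monomial and its remainder take the same values.\<close>

lemma power_red [simp]:
  fixes x :: "'a::{field,finite}"
  shows "x ^ red TYPE('a) c = x ^ c"
proof -
  let ?P = "monom 1 CARD('a) - monom 1 1 :: 'a poly"
  obtain r where r: "monom 1 c mod ?P = monom 1 r"
    using monom_mod_eq_monom by blast
  then have "red TYPE('a) c = r"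
    by (simp add: red_def degree_monom_eq)
  moreover have "poly (monom 1 c) x = poly (monom 1 c div ?P) x * poly ?P x + poly (monom 1 r) x"
    by (metis r div_mult_mod_eq poly_add poly_mult)
  ultimately show ?thesis
    by (simp add: poly_monom finite_field_power_card)
qed

lemma exponent_eqI:
  assumes "a < CARD('a::{field,finite})" "b < CARD('a)"
    and eq: "\<And>x::'a. x ^ a = x ^ b"
  shows "a = b"
proof -
  let ?p = "monom 1 a - monom 1 b :: 'a poly"
  have "?p = 0"
  proof (rule ccontr)
    assume "?p \<noteq> 0"
    then have "card {x. poly ?p x = 0} \<le> degree ?p"
      by (rule card_poly_roots_bound)
    moreover have "{x. poly ?p x = 0} = UNIV"
      by (auto simp: poly_monom eq)
    moreover have "degree ?p < CARD('a)"
      using assms(1,2) by (intro degree_diff_less) (auto simp: degree_monom_eq)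
    ultimately show False
      by simp
  qed
  then show ?thesis
    by (metis degree_monom_eq eq_iff_diff_eq_0 one_neq_zero)
qed

text \<open>Equality of reduced exponents is tested on power functions, where \<open>red\<close>
  disappears and addition becomes multiplication in the field. This gives access to the laws of
  \<open>finsum\<close>.\<close>

lemma comm_monoid_add_exponent_semiring:
  "comm_monoid (add_monoid (exponent_semiring TYPE('a::{field,finite})))"
  by (rule comm_monoidI)
    (auto simp: exponent_semiring_def red_less power_add ac_simps intro!: exponent_eqI[where 'a = 'a])

lemma mult_exponent_closed:
  "a \<otimes>\<^bsub>exponent_semiring TYPE('a::{field,finite})\<^esub> b \<in> carrier (exponent_semiring TYPE('a))"
  by (simp add: exponent_semiring_def red_less)

lemma finsum_exponent_closed:
  assumes "\<And>k. k \<in> S \<Longrightarrow> g k \<in> carrier (exponent_semiring TYPE('a::{field,finite}))"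
  shows "finsum (exponent_semiring TYPE('a)) g S \<in> carrier (exponent_semiring TYPE('a))"
proof -
  interpret abelian_monoid "exponent_semiring TYPE('a)"
    by (rule abelian_monoid.intro) (rule comm_monoid_add_exponent_semiring)
  show ?thesis
    using assms by (intro finsum_closed) auto
qed

text \<open>For fixed \<open>x\<close>, the map \<open>a \<mapsto> x ^ a\<close> turns semiring
  addition into field multiplication. This is how an entry of a matrix product acts as an
  exponent.\<close>

lemma power_finsum_exponent:
  fixes x :: "'a::{field,finite}"
  assumes "finite S" "\<And>k. k \<in> S \<Longrightarrow> g k \<in> carrier (exponent_semiring TYPE('a))"
  shows "x ^ finsum (exponent_semiring TYPE('a)) g S = (\<Prod>k\<in>S. x ^ g k)"
proof -
  interpret abelian_monoid "exponent_semiring TYPE('a)"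
    by (rule abelian_monoid.intro) (rule comm_monoid_add_exponent_semiring)
  have add: "x ^ (a \<oplus>\<^bsub>exponent_semiring TYPE('a)\<^esub> b) = x ^ a * x ^ b" for a b
    by (simp add: exponent_semiring_def power_add)
  have zero: "\<zero>\<^bsub>exponent_semiring TYPE('a)\<^esub> = 0"
    by (simp add: exponent_semiring_def)
  show ?thesis
    using assms
  proof (induction S rule: finite_induct)
    case empty
    then show ?case
      by (simp add: zero)
  next
    case (insert k S)
    then have "finsum (exponent_semiring TYPE('a)) g (insert k S) =
        g k \<oplus>\<^bsub>exponent_semiring TYPE('a)\<^esub> finsum (exponent_semiring TYPE('a)) g S"
      by (intro finsum_insert) auto
    with insert show ?case
      by (simp add: add)
  qed
qed

text \<open>This map is the isomorphism. It accepts every matrix of natural numbers; the bound on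
  the entries enters through the carrier on which it is injective.\<close>

definition monomial_system :: "nat ^ 'n ^ 'n \<Rightarrow> 'a::{field,finite} ^ 'n::finite \<Rightarrow> 'a ^ 'n" where
  "monomial_system F x = (\<chi> i. \<Prod>j\<in>UNIV. (x $ j) ^ (F $ i $ j))"

lemma exponent_matrix_mult_closed:
  "A \<otimes>\<^bsub>exponent_matrix_monoid TYPE('a::{field,finite})\<^esub> B \<in> carrier (exponent_matrix_monoid TYPE('a))"
  by (simp add: exponent_matrix_monoid_def finsum_exponent_closed mult_exponent_closed)

lemma exponent_matrix_one_closed:
  "mat 1 \<in> carrier (exponent_matrix_monoid TYPE('a::{field,finite}))"
  \<comment> \<open>The diagonal entry 1 is an admissible exponent because it lies below
    \<open>q\<close>.\<close>
  using two_le_card_field[where 'a = 'a]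
  by (simp add: exponent_matrix_monoid_def exponent_semiring_def mat_def)

text \<open>Both sides are the double product of the powers of \<open>x $ j\<close> with exponent
  \<open>A $ i $ k * B $ k $ j\<close>. Exchanging the products collects, for each \<open>k\<close>,
  the coordinate \<open>k\<close> of the inner system.\<close>

lemma monomial_system_mult:
  "monomial_system (A \<otimes>\<^bsub>exponent_matrix_monoid TYPE('a::{field,finite})\<^esub> B) =
     (monomial_system A :: 'a ^ 'n::finite \<Rightarrow> _) \<circ> monomial_system B"
proof (rule ext, subst vec_eq_iff, rule allI)
  fix x :: "'a ^ 'n" and i
  let ?E = "exponent_semiring TYPE('a)"
  have "monomial_system (A \<otimes>\<^bsub>exponent_matrix_monoid TYPE('a)\<^esub> B) x $ i =
      (\<Prod>j\<in>UNIV. \<Prod>k\<in>UNIV. (x $ j) ^ (A $ i $ k \<otimes>\<^bsub>?E\<^esub> B $ k $ j))"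
    by (simp add: monomial_system_def exponent_matrix_monoid_def power_finsum_exponent
        mult_exponent_closed)
  also have "\<dots> = (\<Prod>j\<in>UNIV. \<Prod>k\<in>UNIV. ((x $ j) ^ (B $ k $ j)) ^ (A $ i $ k))"
    by (simp add: exponent_semiring_def power_mult[symmetric] mult.commute)
  also have "\<dots> = (monomial_system A \<circ> monomial_system B) x $ i"
    by (subst prod.swap) (simp add: monomial_system_def prod_power_distrib)
  finally show "monomial_system (A \<otimes>\<^bsub>exponent_matrix_monoid TYPE('a)\<^esub> B) x $ i =
      (monomial_system A \<circ> monomial_system B) x $ i" .
qed

lemma monomial_system_one: "monomial_system (mat 1) = (id :: 'a::{field,finite} ^ 'n::finite \<Rightarrow> _)"
proof (rule ext, subst vec_eq_iff, rule allI)
  fix x :: "'a ^ 'n" and i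
  \<comment> \<open>Off the diagonal the factor is a zeroth power, which is 1 even where
    \<open>x $ j = 0\<close>.\<close>
  have "monomial_system (mat 1) x $ i = (\<Prod>j\<in>UNIV. if j = i then x $ j else 1)"
    unfolding monomial_system_def mat_def vec_lambda_beta by (rule prod.cong) auto
  then show "monomial_system (mat 1) x $ i = id x $ i"
    by simp
qed

lemma inj_on_monomial_system:
  "inj_on (monomial_system :: _ \<Rightarrow> 'a::{field,finite} ^ 'n::finite \<Rightarrow> _)
     (carrier (exponent_matrix_monoid TYPE('a)))"
proof (rule inj_onI)
  fix A B :: "nat ^ 'n ^ 'n"
  assume carr: "A \<in> carrier (exponent_matrix_monoid TYPE('a))"
      "B \<in> carrier (exponent_matrix_monoid TYPE('a))"
    and eq: "(monomial_system A :: 'a ^ 'n \<Rightarrow> _) = monomial_system B"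
  \<comment> \<open>A vector with \<open>t\<close> in position \<open>j\<close> and 1 elsewhere
    isolates the power function of a single matrix entry.\<close>
  have at_axis: "monomial_system F (\<chi> k. if k = j then t else 1) $ i = t ^ (F $ i $ j)"
    for F :: "nat ^ 'n ^ 'n" and t :: 'a and i j
  proof -
    have "monomial_system F (\<chi> k. if k = j then t else 1) $ i =
        (\<Prod>k\<in>UNIV. if k = j then t ^ (F $ i $ k) else 1)"
      unfolding monomial_system_def vec_lambda_beta by (rule prod.cong) auto
    then show ?thesis
      by simp
  qed
  have "A $ i $ j = B $ i $ j" for i j
  proof (rule exponent_eqI[where 'a = 'a])
    show "t ^ (A $ i $ j) = t ^ (B $ i $ j)" for t :: 'a
      using at_axis[of A j t i] at_axis[of B j t i] by (simp add: eq)
  qed (use carr in \<open>auto simp: exponent_matrix_monoid_def exponent_semiring_def\<close>)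
  then show "A = B"
    by (simp add: vec_eq_iff)
qed

lemma monomial_system_image:
  "monomial_system ` carrier (exponent_matrix_monoid TYPE('a)) =
     (monomial_systems :: ('a::{field,finite} ^ 'n::finite \<Rightarrow> _) set)"
proof -
  have "monomial_systems = {f :: 'a ^ 'n \<Rightarrow> _. \<exists>F \<in> carrier (exponent_matrix_monoid TYPE('a)). f = monomial_system F}"
    by (simp add: monomial_systems_def monomial_system_def exponent_matrix_monoid_def fun_eq_iff
        vec_eq_iff Bex_def)
  then show ?thesis
    by blast
qed

theorem theorem14:
  fixes M :: "(nat ^ 'n ^ 'n::finite) monoid"
    and MF :: "('a::{field,finite} ^ 'n \<Rightarrow> 'a ^ 'n) monoid"
  defines "M \<equiv> exponent_matrix_monoid TYPE('a)"
    and "MF \<equiv> monomial_system_monoid"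
  shows "monoid M \<and> monoid MF \<and> (\<exists>\<Phi> \<in> iso M MF. \<Phi> \<one>\<^bsub>M\<^esub> = \<one>\<^bsub>MF\<^esub>)"
proof -
  let ?\<Phi> = "monomial_system :: _ \<Rightarrow> 'a ^ 'n \<Rightarrow> _"
  have one: "\<one>\<^bsub>M\<^esub> = mat 1" "\<one>\<^bsub>MF\<^esub> = id" "mat 1 \<in> carrier M"
    and closed: "\<And>A B. A \<otimes>\<^bsub>M\<^esub> B \<in> carrier M"
    and MF: "carrier MF = ?\<Phi> ` carrier M" "\<And>f g. f \<otimes>\<^bsub>MF\<^esub> g = f \<circ> g"
    and hom: "\<And>A B. ?\<Phi> (A \<otimes>\<^bsub>M\<^esub> B) = ?\<Phi> A \<circ> ?\<Phi> B"
    and inj: "inj_on ?\<Phi> (carrier M)"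
    unfolding M_def MF_def
    using exponent_matrix_one_closed exponent_matrix_mult_closed monomial_system_mult
      inj_on_monomial_system monomial_system_image
    by (auto simp: monomial_system_monoid_def) (auto simp: exponent_matrix_monoid_def)
  \<comment> \<open>The laws are pulled back along the injective map. Keeping \<open>1\<close> from
    becoming \<open>Suc 0\<close> lets \<open>monomial_system_one\<close> match the unit
    matrix.\<close>
  have "monoid M"
    by (rule monoidI)
      (auto simp: one closed hom monomial_system_one comp_assoc simp del: One_nat_def intro!: inj_onD[OF inj])
  moreover have "monoid MF"
  proof (rule monoidI)
    show "f \<otimes>\<^bsub>MF\<^esub> g \<in> carrier MF" if "f \<in> carrier MF" "g \<in> carrier MF" for f g
      \<comment> \<open>Read from right to left, \<open>hom\<close> supplies the matrix that
        represents the composite.\<close>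
      using that closed by (auto simp: MF simp flip: hom)
    show "\<one>\<^bsub>MF\<^esub> \<in> carrier MF"
      using one by (metis MF(1) imageI monomial_system_one)
  qed (auto simp: MF one comp_assoc)
  moreover have "?\<Phi> \<in> iso M MF"
    using inj by (auto simp: iso_def hom_def bij_betw_def MF hom)
  \<comment> \<open>Membership in \<open>iso\<close> speaks only of products and bijectivity;
    preservation of the unit comes from \<open>monomial_system_one\<close>.\<close>
  ultimately show ?thesis
    using one monomial_system_one by metis
qed

end
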